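(* For all integers $n,r\ge 0$ and $j\ge 1$, $$p^{r+1}_j(n)=2\,p^r_j(n)-p^r_{j-1}(n).$$
   Context: A preferential arrangement of a finite set $S$ is an ordered set partition of $S$ (a sequence of nonempty pairwise disjoint blocks with union $S$); the empty set has exactly one. Let $a(w)$ be the number of preferential arrangements of a $w$-element set ($a(0)=1$). A barred preferential arrangement of $X_n=\{1,\dots,n\}$ with $k$ bars is a sequence of $k+1$ possibly empty, pairwise disjoint sections with union $X_n$, each equipped with a preferential arrangement of its elements. A restricted section is one whose preferential arrangement has at most one block (exactly one choice); a free section may carry any preferential arrangement. For integers $r,j\ge0$, $p^r_j(n)$ is the number of barred preferential arrangements of $X_n$ with $r+j$ sections ($r+j-1$ bars) in which $r$ fixed sections are restricted and $j$ fixed sections are free; equivalently $p^r_j(n)=\sum_{w_1+\cdots+w_{r+j}=n}\frac{n!}{w_1!\cdots w_{r+j}!}\prod_{i=r+1}^{r+j}a(w_i)$ (sum over nonnegative integer solutions; for $r=j=0$ this is the empty-sum/empty-product convention giving $1$ if $n=0$ and $0$ otherwise). In particular $p^r_0(n)=r^n$ with $0^0=1$. *)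

theory Defs
  imports Main "HOL-Library.Disjoint_Sets"
begin

definition pref_arrangements :: "'a set \<Rightarrow> 'a set list set" where
  "pref_arrangements S = {bs. distinct bs \<and> partition_on S (set bs)}"

(* A section is stored as its preferential arrangement bs; the underlying set of elements is
   the union of the blocks. *)
definition section_set :: "'a set list \<Rightarrow> 'a set" where
  "section_set bs = \<Union> (set bs)"

(* Indexed by the number m of sections, i.e. m - 1 bars, so that m = 0 makes sense: it yields
   only the empty sequence, and only for X = {}.  Disjointness is by index because several
   sections may be empty. *)
definition barred_pref_arrangements :: "nat \<Rightarrow> 'a set \<Rightarrow> 'a set list list set" where
  "barred_pref_arrangements m X =
     {A. length A = m \<and>
         (\<forall>i<m. A ! i \<in> pref_arrangements (section_set (A ! i))) \<and>
         disjoint_family_on (\<lambda>i. section_set (A ! i)) {..<m} \<and>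
         (\<Union>i<m. section_set (A ! i)) = X}"

(* The r restricted sections are the first r, the j free ones the last j. *)
definition p :: "nat \<Rightarrow> nat \<Rightarrow> nat \<Rightarrow> nat" where
  "p r j n = card {A \<in> barred_pref_arrangements (r + j) {1..n}. \<forall>i<r. length (A ! i) \<le> 1}"

(* The cardinality in the definition of p is a genuine count. *)
lemma finite_barred_pref_arrangements:
  assumes "finite X"
  shows "finite (barred_pref_arrangements m X)"
proof -
  let ?B = "{bs. set bs \<subseteq> Pow X \<and> distinct bs}"
  have "finite ?B"
    using assms by (intro finite_subset_distinct) simp
  then have "finite {A. set A \<subseteq> ?B \<and> length A = m}"
    by (rule finite_lists_length_eq)
  moreover have "barred_pref_arrangements m X \<subseteq> {A. set A \<subseteq> ?B \<and> length A = m}"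
  proof
    fix A assume A: "A \<in> barred_pref_arrangements m X"
    have "bs \<in> ?B" if "bs \<in> set A" for bs
    proof -
      from that A obtain i where i: "i < m" "bs = A ! i"
        by (auto simp: in_set_conv_nth barred_pref_arrangements_def)
      with A have "bs \<in> pref_arrangements (section_set bs)" "section_set bs \<subseteq> X"
        unfolding barred_pref_arrangements_def by blast+
      then show ?thesis
        by (auto simp: pref_arrangements_def section_set_def)
    qed
    with A show "A \<in> {A. set A \<subseteq> ?B \<and> length A = m}"
      by (auto simp: barred_pref_arrangements_def)
  qed
  ultimately show ?thesis
    by (rule finite_subset[rotated])
qed

end

theory Submission imports Defs begin

text \<open>Prepending the last restricted section \<open>R\<close> to the first free section \<open>bs\<close> turns an
  arrangement with \<open>r + 1\<close> restricted sections into one with \<open>r\<close> of them. A given first free section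
  \<open>cs\<close> arises from \<open>R = []\<close>, \<open>bs = cs\<close>, and, if it is nonempty, also from \<open>R = [hd cs]\<close>,
  \<open>bs = tl cs\<close>. So each arrangement has two preimages, except that there is only one if \<open>cs = []\<close>;
  deleting the empty \<open>cs\<close> shows that these exceptions are counted by \<open>p r (j - 1) n\<close>.\<close>

text \<open>Distinct blocks of a partition are disjoint and blocks are nonempty, so distinctness
  across the cut amounts to disjointness of the two unions.\<close>

lemma pref_arrangements_append:
  "xs @ ys \<in> pref_arrangements (section_set (xs @ ys)) \<longleftrightarrow>
     xs \<in> pref_arrangements (section_set xs) \<and> ys \<in> pref_arrangements (section_set ys) \<and>
     section_set xs \<inter> section_set ys = {}" (is "?L \<longleftrightarrow> ?R")
proof
  assume L: ?L
  then have "B \<inter> C = {}" if "B \<in> set xs" "C \<in> set ys" for B C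
  proof -
    have "B \<noteq> C" "disjoint (set xs \<union> set ys)"
      using L that by (auto simp: pref_arrangements_def partition_on_def)
    then show ?thesis
      using that by (auto dest: disjointD)
  qed
  then have "section_set xs \<inter> section_set ys = {}"
    unfolding section_set_def by blast
  with L show ?R
    by (auto simp: pref_arrangements_def partition_on_def section_set_def disjoint_def)
next
  assume R: ?R
  then have "B \<inter> C = {}" if "B \<in> set xs" "C \<in> set ys" for B C
    using that unfolding section_set_def by blast
  moreover have "{} \<notin> set xs"
    using R by (auto simp: pref_arrangements_def partition_on_def)
  \<comment> \<open>A common block would be disjoint from itself, hence empty.\<close>
  ultimately have "set xs \<inter> set ys = {}"
    by fastforce
  moreover have "disjoint (set xs \<union> set ys)"
    using R by (intro disjoint_union)
      (auto simp: pref_arrangements_def partition_on_def section_set_def)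
  ultimately show ?L
    using R by (auto simp: pref_arrangements_def partition_on_def section_set_def)
qed

lemma section_set_concat: "section_set (concat A) = (\<Union>i<length A. section_set (A ! i))"
  by (induction A) (auto simp: section_set_def lessThan_Suc_eq_insert_0)

lemma disjoint_family_on_Suc:
  "disjoint_family_on F {..<Suc m} \<longleftrightarrow>
     F 0 \<inter> (\<Union>i<m. F (Suc i)) = {} \<and> disjoint_family_on (\<lambda>i. F (Suc i)) {..<m}"
  unfolding lessThan_Suc_eq_insert_0
  by (subst disjoint_family_on_insert) (auto simp: disjoint_family_on_def)

lemma concat_in_pref_arrangements_iff:
  "concat A \<in> pref_arrangements (section_set (concat A)) \<longleftrightarrow>
     (\<forall>i<length A. A ! i \<in> pref_arrangements (section_set (A ! i))) \<and>
     disjoint_family_on (\<lambda>i. section_set (A ! i)) {..<length A}"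
proof (induction A)
  case Nil
  show ?case
    by (simp add: pref_arrangements_def section_set_def disjoint_family_on_def partition_on_empty)
next
  case (Cons bs A)
  show ?case
    by (auto simp: pref_arrangements_append Cons.IH disjoint_family_on_Suc All_less_Suc2
        simp flip: section_set_concat)
qed

text \<open>Bars merely cut one preferential arrangement of \<open>X\<close> into \<open>m\<close>
  consecutive, possibly empty pieces. Moving a block across a bar therefore needs no new check of
  disjointness or covering.\<close>

lemma barred_pref_arrangements_eq:
  fixes X :: "'a set"
  shows "barred_pref_arrangements m X = {A. length A = m \<and> concat A \<in> pref_arrangements X}"
proof -
  have pref: "bs \<in> pref_arrangements X \<longleftrightarrow>
      bs \<in> pref_arrangements (section_set bs) \<and> section_set bs = X" for bs :: "'a set list"
    by (auto simp: pref_arrangements_def partition_on_def section_set_def)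
  have "A \<in> barred_pref_arrangements m X \<longleftrightarrow> length A = m \<and> concat A \<in> pref_arrangements X" for A
    by (subst pref, subst concat_in_pref_arrangements_iff)
      (auto simp: barred_pref_arrangements_def section_set_concat)
  then show ?thesis by blast
qed

text \<open>Keeping restricted and free sections in separate lists places the two sections to be
  changed at the end of \<open>us\<close> and the start of \<open>vs\<close>.\<close>

definition split_barred :: "nat \<Rightarrow> nat \<Rightarrow> 'a set \<Rightarrow> ('a set list list \<times> 'a set list list) set" where
  "split_barred r j X = {(us, vs). length us = r \<and> length vs = j \<and>
     (\<forall>bs\<in>set us. length bs \<le> 1) \<and> concat us @ concat vs \<in> pref_arrangements X}"

lemma bij_betw_split_barred:
  "bij_betw (\<lambda>(us, vs). us @ vs) (split_barred r j X)
     {A \<in> barred_pref_arrangements (r + j) X. \<forall>i<r. length (A ! i) \<le> 1}"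
proof -
  \<comment> \<open>The prescribed lengths fix the cut, so \<open>us @ vs\<close> determines the
    pair.\<close>
  have iff: "(us, vs) \<in> split_barred r j X \<longleftrightarrow> length us = r \<and> length vs = j \<and>
      us @ vs \<in> {A \<in> barred_pref_arrangements (r + j) X. \<forall>i<r. length (A ! i) \<le> 1}" for us vs
    by (auto simp: split_barred_def barred_pref_arrangements_eq all_set_conv_all_nth nth_append)
  show ?thesis
  proof (rule bij_betwI[where g = "\<lambda>A. (take r A, drop r A)"])
    show "(\<lambda>A. (take r A, drop r A)) \<in>
      {A \<in> barred_pref_arrangements (r + j) X. \<forall>i<r. length (A ! i) \<le> 1} \<rightarrow> split_barred r j X"
      by (auto simp: iff barred_pref_arrangements_eq)
  qed (auto simp: iff barred_pref_arrangements_eq)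
qed

lemma finite_split_barred: "finite X \<Longrightarrow> finite (split_barred r j X)"
  using bij_betw_finite[OF bij_betw_split_barred] finite_barred_pref_arrangements by fastforce

lemma p_eq_card_split_barred: "p r j n = card (split_barred r j {1..n})"
  unfolding p_def using bij_betw_same_card[OF bij_betw_split_barred] by metis

text \<open>The recurrence without subtraction. Instead of counting fibres, the larger set is
  written as a disjoint union of two injective images, one of all of \<open>?T\<close> and one of
  \<open>?N\<close>.\<close>

lemma card_split_barred_Suc:
  fixes X :: "'a set"
  assumes "finite X"
  shows "card (split_barred (Suc r) (Suc j) X) + card (split_barred r j X) =
    2 * card (split_barred r (Suc j) X)"
proof -
  let ?T = "split_barred r (Suc j) X"
  let ?E = "{x \<in> ?T. hd (snd x) = []}" and ?N = "{x \<in> ?T. hd (snd x) \<noteq> []}"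
  define add_empty :: "'a set list list \<times> 'a set list list \<Rightarrow> _"
    where "add_empty = (\<lambda>(us, vs). (us @ [[]], vs))"
  \<comment> \<open>Moves the first block of the first free section into a new last restricted
    section, leaving the concatenation unchanged. It is applied only on \<open>?N\<close>, where
    \<open>hd vs\<close> is nonempty.\<close>
  define split_off :: "'a set list list \<times> 'a set list list \<Rightarrow> _"
    where "split_off = (\<lambda>(us, vs). (us @ [[hd (hd vs)]], tl (hd vs) # tl vs))"
  have fin: "finite ?T"
    using assms by (rule finite_split_barred)
  \<comment> \<open>An empty section contributes nothing to the concatenation, so it can be inserted
    or deleted freely.\<close>
  have "?E = (\<lambda>(us, vs). (us, [] # vs)) ` split_barred r j X"
    by (force simp: split_barred_def length_Suc_conv image_iff)
  moreover have "inj_on (\<lambda>(us, vs). (us, [] # vs)) (split_barred r j X)"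
    by (auto simp: inj_on_def)
  ultimately have E: "card ?E = card (split_barred r j X)"
    by (simp add: card_image)
  have img: "split_barred (Suc r) (Suc j) X = add_empty ` ?T \<union> split_off ` ?N"
  proof (intro equalityI subsetI)
    fix x assume x: "x \<in> split_barred (Suc r) (Suc j) X"
    then obtain us' vs' where "x = (us', vs')" "length us' = Suc r" "length vs' = Suc j"
      by (auto simp: split_barred_def)
    then obtain us R bs vs where eq: "x = (us @ [R], bs # vs)"
      by (metis length_Suc_conv length_Suc_conv_rev)
    show "x \<in> add_empty ` ?T \<union> split_off ` ?N"
    proof (cases R)
      case Nil
      with x eq have "(us, bs # vs) \<in> ?T" "x = add_empty (us, bs # vs)"
        by (auto simp: split_barred_def add_empty_def)
      then show ?thesis by blast
    next
      \<comment> \<open>\<open>R\<close> is restricted, so \<open>Bs\<close> is empty and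
        \<open>R = [B]\<close>.\<close>
      case (Cons B Bs)
      with x eq have "(us, (B # bs) # vs) \<in> ?N" "x = split_off (us, (B # bs) # vs)"
        by (auto simp: split_barred_def split_off_def)
      then show ?thesis by blast
    qed
  next
    fix x assume "x \<in> add_empty ` ?T \<union> split_off ` ?N"
    then show "x \<in> split_barred (Suc r) (Suc j) X"
      by (auto simp: split_barred_def add_empty_def split_off_def length_Suc_conv[of _ j] neq_Nil_conv)
  qed
  have "inj_on add_empty ?T"
    by (auto simp: inj_on_def add_empty_def)
  moreover have "inj_on split_off ?N"
    \<comment> \<open>The left inverse puts the single block of the last restricted section back in
      front of the first free one.\<close>
    by (rule inj_on_inverseI[where
          g = "\<lambda>(us, vs). (butlast us, (hd (last us) # hd vs) # tl vs)"])
      (auto simp: split_off_def split_barred_def length_Suc_conv)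
  \<comment> \<open>The last restricted section is empty in one image and a singleton in the
    other.\<close>
  moreover have "add_empty ` ?T \<inter> split_off ` ?N = {}"
    by (auto simp: add_empty_def split_off_def)
  ultimately have "card (split_barred (Suc r) (Suc j) X) = card ?T + card ?N"
    unfolding img using fin by (simp add: card_Un_disjoint card_image)
  moreover have "card ?T = card ?E + card ?N"
    using fin by (subst card_Un_disjoint[symmetric]) (auto intro: arg_cong[where f = card])
  ultimately show ?thesis
    using E by simp
qed

theorem theorem7:
  fixes n r j :: nat
  assumes "j \<ge> 1"
  shows "int (p (r + 1) j n) = 2 * int (p r j n) - int (p r (j - 1) n)"
proof -
  obtain k where "j = Suc k"
    using assms by (cases j) auto
  then show ?thesis
    using card_split_barred_Suc[of "{1..n}" r k] by (simp add: p_eq_card_split_barred)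
qed

end
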